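(* Let $f$ and $b$ be smooth real functions on an open interval $\Omega_u\subset\mathbb R$ with $b'(u)>0$. Consider the system for $U=(u,w)^T$ ($u,w$ scalar functions of $(x,t)$, $x\in\mathbb R$) $$\partial_tu+\frac1\varepsilon\partial_xw=0,\qquad \partial_tw+\frac1\varepsilon\partial_xb(u)=-\frac{w}{\varepsilon^2}+\frac{f(u)}{\varepsilon},$$ which is obtained from $\partial_tu+\partial_xv=0$, $\varepsilon^2\partial_tv+\partial_xb(u)=-v+f(u)$ by setting $w=\varepsilon v$. Write it as $\partial_tU+\frac1\varepsilon A(U;\varepsilon)\partial_xU=\frac1{\varepsilon^2}Q(U;\varepsilon)$ with $$A=\begin{pmatrix} 0 & 1 \\ b'(u) & 0 \end{pmatrix},\qquad Q=\begin{pmatrix} 0 \\ -w+\varepsilon f(u) \end{pmatrix}.$$ Then this system satisfies the convergence criteria (i), (ii), (iii), (iv), (v) listed in the context, with the symmetrizer $$A_0(U;\varepsilon)=\begin{pmatrix} b'(u) & \varepsilon f'(u) \\ \varepsilon f'(u) & 1 \end{pmatrix},$$ where positive definiteness in (iii) is asserted for all $(U;\varepsilon)$ with $\varepsilon$ small enough that $\varepsilon|f'(u)|<\sqrt{b'(u)}$. Moreover, its limit equation (as defined in the context) is the convection-diffusion equation $\partial_tu+\partial_xf(u)=\partial_{xx}b(u)$.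
   Context: Convergence criteria. Let $\partial_tU+\frac1\varepsilon\sum_{j=1}^dA_j(U;\varepsilon)\partial_{x_j}U=\frac1{\varepsilon^2}Q(U;\varepsilon)$ be a first-order system for $U=(u,w)^T\in\Omega\subset\mathbb R^n$, $u\in\mathbb R^{n-r}$, $w\in\mathbb R^r$, with parameter $\varepsilon\in(0,1]$; $A_j$ and $Q$ are smooth in $(U;\varepsilon)$, up to $\varepsilon=0$. $\Omega_u\subset\mathbb R^{n-r}$ is an open convex set (the state space of $u$), $\Omega$ is open, $(u,w)\in\Omega$ implies $u\in\Omega_u$, and $(u,0)\in\Omega$ for $u\in\Omega_u$. An $n\times n$ matrix $A$ is partitioned as $\begin{pmatrix} A^{11} & A^{12} \\ A^{21} & A^{22} \end{pmatrix}$ according to $n=(n-r)+r$. The criteria are: (i) $Q(U;\varepsilon)=(0,q(U;\varepsilon))^T$ with $q$ a smooth $\mathbb R^r$-valued function. (ii) $q(u,w;0)=0$ if and only if $w=0$, and $\partial_wq(u,0;0)$ is invertible for all $u\in\Omega_u$. (iii) There is a symmetric positive definite matrix $A_0(U;\varepsilon)$ (symmetrizer) such that $A_0(U;\varepsilon)A_j(U;\varepsilon)=A_j(U;\varepsilon)^TA_0(U;\varepsilon)$ for all $U\in\Omega$ and all $j$. (iv) With this $A_0$, there is a symmetric positive definite $r\times r$ matrix $S(u)$ such that $A_0(u,0;0)\,\partial_UQ(u,0;0)+(\partial_UQ(u,0;0))^TA_0(u,0;0)\le-\begin{pmatrix} 0 & 0 \\ 0 & S(u) \end{pmatrix}$ for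 all $u\in\Omega_u$. (v) $A_j^{11}(u,0;0)=0$ and $\partial_uA_j^{11}(u,0;0)=0$ for all $u\in\Omega_u$ and all $j$. Limit equation. This is the equation for the leading term $u_0$ in the formal expansion $u\sim u_0+\varepsilon u_1+\cdots$, $w\sim w_0+\varepsilon w_1+\cdots$; explicitly $w_0=0$, $w_1=\partial_wq(u_0,0;0)^{-1}\big[\sum_jA_j^{21}(u_0,0;0)\partial_{x_j}u_0-\partial_\varepsilon q(u_0,0;0)\big]$ and $$\partial_tu_0+\sum_jA_j^{12}(u_0,0;0)\partial_{x_j}w_1+\sum_j\big(\partial_wA_j^{11}(u_0,0;0)[w_1]\big)\partial_{x_j}u_0+\sum_j\partial_\varepsilon A_j^{11}(u_0,0;0)\partial_{x_j}u_0=0.$$ Here $d=1$, $n=2$, $r=1$. *)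

theory Defs
  imports "HOL-Analysis.Analysis"
begin

section \<open>Smooth functions\<close>

text \<open>For open sets: all partial derivatives up to order k exist and are continuous.\<close>

primrec Ck_on :: "nat \<Rightarrow> 'a::euclidean_space set \<Rightarrow> ('a \<Rightarrow> 'b::real_normed_vector) \<Rightarrow> bool" where
  "Ck_on 0 S f \<longleftrightarrow> continuous_on S f"
| "Ck_on (Suc k) S f \<longleftrightarrow>
     (\<forall>x\<in>S. f differentiable (at x)) \<and>
     (\<forall>v. Ck_on k S (\<lambda>x. frechet_derivative f (at x) v))"

text \<open>On an arbitrary set, such as \<open>\<Omega> \<times> [0,1]\<close>, smooth means being the restriction of a
  smooth function on an open neighbourhood.\<close>

definition smooth_on :: "'a::euclidean_space set \<Rightarrow> ('a \<Rightarrow> 'b::real_normed_vector) \<Rightarrow> bool" where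
  "smooth_on S f \<longleftrightarrow>
     (\<exists>T g. open T \<and> S \<subseteq> T \<and> (\<forall>x\<in>S. g x = f x) \<and> (\<forall>k. Ck_on k T g))"

section \<open>States, blocks and matrices\<close>

text \<open>A state in \<open>\<real>\<^sup>n\<close>, \<open>n = (n - r) + r\<close>, is a vector indexed by \<open>'p + 'r\<close> with
  \<open>CARD('p) = n - r\<close> and \<open>CARD('r) = r\<close>.\<close>

definition state :: "real^'p \<Rightarrow> real^'r \<Rightarrow> real^('p::finite+'r::finite)" where
  "state u w = (\<chi> i. case i of Inl a \<Rightarrow> u $ a | Inr a \<Rightarrow> w $ a)"

definition upart :: "real^('p::finite+'r::finite) \<Rightarrow> real^'p" where
  "upart U = (\<chi> i. U $ Inl i)"

definition wpart :: "real^('p::finite+'r::finite) \<Rightarrow> real^'r" where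
  "wpart U = (\<chi> i. U $ Inr i)"

definition block11 :: "real^('p::finite+'r::finite)^('p+'r) \<Rightarrow> real^'p^'p" where
  "block11 M = (\<chi> i j. M $ Inl i $ Inl j)"

definition block12 :: "real^('p::finite+'r::finite)^('p+'r) \<Rightarrow> real^'r^'p" where
  "block12 M = (\<chi> i j. M $ Inl i $ Inr j)"

definition block21 :: "real^('p::finite+'r::finite)^('p+'r) \<Rightarrow> real^'p^'r" where
  "block21 M = (\<chi> i j. M $ Inr i $ Inl j)"

definition block_matrix ::
  "real^'p^'p \<Rightarrow> real^'r^'p \<Rightarrow> real^'p^'r \<Rightarrow> real^'r^'r \<Rightarrow> real^('p::finite+'r::finite)^('p+'r)" where
  "block_matrix M11 M12 M21 M22 =
     (\<chi> i j. case i of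
        Inl a \<Rightarrow> (case j of Inl c \<Rightarrow> M11 $ a $ c | Inr c \<Rightarrow> M12 $ a $ c)
      | Inr a \<Rightarrow> (case j of Inl c \<Rightarrow> M21 $ a $ c | Inr c \<Rightarrow> M22 $ a $ c))"

definition sym_matrix :: "real^'m^'m \<Rightarrow> bool" where
  "sym_matrix M \<longleftrightarrow> transpose M = M"

definition pos_def :: "real^'m^'m \<Rightarrow> bool" where
  "pos_def M \<longleftrightarrow> (\<forall>x. x \<noteq> 0 \<longrightarrow> x \<bullet> (M *v x) > 0)"

definition loewner_le :: "real^'m^'m \<Rightarrow> real^'m^'m \<Rightarrow> bool" where
  "loewner_le M N \<longleftrightarrow> (\<forall>x. x \<bullet> (M *v x) \<le> x \<bullet> (N *v x))"

section \<open>First-order systems with relaxation\<close>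

text \<open>The coefficients are \<open>A j U \<epsilon>\<close> (\<open>j\<close> ranging over the \<open>CARD('d)\<close> space directions)
  and \<open>Q U \<epsilon>\<close>; only \<open>U \<in> \<Omega>\<close> and \<open>\<epsilon> \<in> [0,1]\<close> matter.\<close>

type_synonym ('p, 'r) mat_fun = "real^('p+'r) \<Rightarrow> real \<Rightarrow> real^('p+'r)^('p+'r)"
type_synonym ('p, 'r) vec_fun = "real^('p+'r) \<Rightarrow> real \<Rightarrow> real^('p+'r)"

definition state_spaces :: "(real^'p) set \<Rightarrow> (real^('p::finite+'r::finite)) set \<Rightarrow> bool" where
  "state_spaces \<Omega>u \<Omega> \<longleftrightarrow>
     open \<Omega>u \<and> convex \<Omega>u \<and> open \<Omega> \<and>
     (\<forall>u w. state u w \<in> \<Omega> \<longrightarrow> u \<in> \<Omega>u) \<and> (\<forall>u\<in>\<Omega>u. state u 0 \<in> \<Omega>)"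

definition smooth_coefficients ::
  "(real^('p::finite+'r::finite)) set \<Rightarrow> ('d \<Rightarrow> ('p,'r) mat_fun) \<Rightarrow> ('p,'r) vec_fun \<Rightarrow> bool" where
  "smooth_coefficients \<Omega> A Q \<longleftrightarrow>
     (\<forall>j. smooth_on (\<Omega> \<times> {0..1}) (\<lambda>(U, \<epsilon>). A j U \<epsilon>)) \<and>
     smooth_on (\<Omega> \<times> {0..1}) (\<lambda>(U, \<epsilon>). Q U \<epsilon>)"

definition partial_x ::
  "'d \<Rightarrow> (real^'d \<Rightarrow> real \<Rightarrow> 'a::real_normed_vector) \<Rightarrow> real^'d \<Rightarrow> real \<Rightarrow> 'a" where
  "partial_x j g x t = vector_derivative (\<lambda>s. g (x + s *\<^sub>R axis j 1) t) (at 0)"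

definition partial_t ::
  "(real^'d \<Rightarrow> real \<Rightarrow> 'a::real_normed_vector) \<Rightarrow> real^'d \<Rightarrow> real \<Rightarrow> 'a" where
  "partial_t g x t = vector_derivative (\<lambda>s. g x s) (at t)"

definition system_equation ::
  "('d::finite \<Rightarrow> ('p::finite,'r::finite) mat_fun) \<Rightarrow> ('p,'r) vec_fun \<Rightarrow> real \<Rightarrow>
   (real^'d \<Rightarrow> real \<Rightarrow> real^('p::finite+'r::finite)) \<Rightarrow> real^'d \<Rightarrow> real \<Rightarrow> bool" where
  "system_equation A Q \<epsilon> U x t \<longleftrightarrow>
     partial_t U x t + (1 / \<epsilon>) *\<^sub>R (\<Sum>j\<in>UNIV. A j (U x t) \<epsilon> *v partial_x j U x t)
       = (1 / \<epsilon>\<^sup>2) *\<^sub>R Q (U x t) \<epsilon>"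

subsection \<open>Derivatives of the coefficients at \<open>(u, 0; 0)\<close>\<close>

definition q_of :: "('p,'r) vec_fun \<Rightarrow> real^('p::finite+'r::finite) \<Rightarrow> real \<Rightarrow> real^'r" where
  "q_of Q U \<epsilon> = wpart (Q U \<epsilon>)"

definition dw_q :: "('p::finite,'r::finite) vec_fun \<Rightarrow> real^'p \<Rightarrow> real^'r^'r" where
  "dw_q Q u = matrix (frechet_derivative (\<lambda>w. q_of Q (state u w) 0) (at 0))"

definition deps_q :: "('p::finite,'r::finite) vec_fun \<Rightarrow> real^'p \<Rightarrow> real^'r" where
  "deps_q Q u = vector_derivative (\<lambda>\<epsilon>. q_of Q (state u 0) \<epsilon>) (at 0 within {0..1})"

definition dU_Q :: "('p::finite,'r::finite) vec_fun \<Rightarrow> real^'p \<Rightarrow> real^('p::finite+'r::finite)^('p+'r)" where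
  "dU_Q Q u = matrix (frechet_derivative (\<lambda>U. Q U 0) (at (state u 0)))"

definition dw_A11 :: "('p::finite,'r::finite) mat_fun \<Rightarrow> real^'p \<Rightarrow> real^'r \<Rightarrow> real^'p^'p" where
  "dw_A11 A u w1 = frechet_derivative (\<lambda>w. block11 (A (state u w) 0)) (at 0) w1"

definition deps_A11 :: "('p::finite,'r::finite) mat_fun \<Rightarrow> real^'p \<Rightarrow> real^'p^'p" where
  "deps_A11 A u = vector_derivative (\<lambda>\<epsilon>. block11 (A (state u 0) \<epsilon>)) (at 0 within {0..1})"

section \<open>The convergence criteria\<close>

definition criterion_i :: "(real^('p::finite+'r::finite)) set \<Rightarrow> ('p,'r) vec_fun \<Rightarrow> bool" where
  "criterion_i \<Omega> Q \<longleftrightarrow>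
     (\<forall>U\<in>\<Omega>. \<forall>\<epsilon>\<in>{0..1}. Q U \<epsilon> = state 0 (q_of Q U \<epsilon>)) \<and>
     smooth_on (\<Omega> \<times> {0..1}) (\<lambda>(U, \<epsilon>). q_of Q U \<epsilon>)"

definition criterion_ii ::
  "(real^'p::finite) set \<Rightarrow> (real^('p+'r::finite)) set \<Rightarrow> ('p,'r) vec_fun \<Rightarrow> bool" where
  "criterion_ii \<Omega>u \<Omega> Q \<longleftrightarrow>
     (\<forall>u w. state u w \<in> \<Omega> \<longrightarrow> (q_of Q (state u w) 0 = 0 \<longleftrightarrow> w = 0)) \<and>
     (\<forall>u\<in>\<Omega>u. invertible (dw_q Q u))"

text \<open>\<open>P\<close> is the set of \<open>(U, \<epsilon>)\<close> at which \<open>A0 U \<epsilon>\<close> is asserted to be positive definite.\<close>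

definition criterion_iii ::
  "(real^('p::finite+'r::finite)) set \<Rightarrow> ((real^('p+'r)) \<times> real) set \<Rightarrow>
   ('d \<Rightarrow> ('p,'r) mat_fun) \<Rightarrow> ('p,'r) mat_fun \<Rightarrow> bool" where
  "criterion_iii \<Omega> P A A0 \<longleftrightarrow>
     (\<forall>U\<in>\<Omega>. \<forall>\<epsilon>\<in>{0..1}.
        sym_matrix (A0 U \<epsilon>) \<and>
        ((U, \<epsilon>) \<in> P \<longrightarrow> pos_def (A0 U \<epsilon>)) \<and>
        (\<forall>j. A0 U \<epsilon> ** A j U \<epsilon> = transpose (A j U \<epsilon>) ** A0 U \<epsilon>))"

definition criterion_iv ::
  "(real^'p::finite) set \<Rightarrow> ('p,'r::finite) vec_fun \<Rightarrow> ('p,'r) mat_fun \<Rightarrow> bool" where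
  "criterion_iv \<Omega>u Q A0 \<longleftrightarrow>
     (\<exists>S :: real^'p \<Rightarrow> real^'r^'r. \<forall>u\<in>\<Omega>u.
        sym_matrix (S u) \<and> pos_def (S u) \<and>
        loewner_le
          (A0 (state u 0) 0 ** dU_Q Q u + transpose (dU_Q Q u) ** A0 (state u 0) 0)
          (- block_matrix 0 0 0 (S u)))"

definition criterion_v ::
  "(real^'p::finite) set \<Rightarrow> ('d \<Rightarrow> ('p,'r::finite) mat_fun) \<Rightarrow> bool" where
  "criterion_v \<Omega>u A \<longleftrightarrow>
     (\<forall>u\<in>\<Omega>u. \<forall>j. block11 (A j (state u 0) 0) = 0 \<and>
        ((\<lambda>v. block11 (A j (state v 0) 0)) has_derivative (\<lambda>_. 0)) (at u))"

section \<open>The limit equation\<close>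

definition limit_w1 ::
  "('d::finite \<Rightarrow> ('p::finite,'r::finite) mat_fun) \<Rightarrow> ('p,'r) vec_fun \<Rightarrow>
   (real^'d \<Rightarrow> real \<Rightarrow> real^'p) \<Rightarrow> real^'d \<Rightarrow> real \<Rightarrow> real^'r" where
  "limit_w1 A Q u0 x t =
     matrix_inv (dw_q Q (u0 x t)) *v
       ((\<Sum>j\<in>UNIV. block21 (A j (state (u0 x t) 0) 0) *v partial_x j u0 x t)
        - deps_q Q (u0 x t))"

definition limit_equation ::
  "('d::finite \<Rightarrow> ('p::finite,'r::finite) mat_fun) \<Rightarrow> ('p,'r) vec_fun \<Rightarrow>
   (real^'d \<Rightarrow> real \<Rightarrow> real^'p) \<Rightarrow> real^'d \<Rightarrow> real \<Rightarrow> bool" where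
  "limit_equation A Q u0 x t \<longleftrightarrow>
     partial_t u0 x t
     + (\<Sum>j\<in>UNIV. block12 (A j (state (u0 x t) 0) 0) *v partial_x j (limit_w1 A Q u0) x t)
     + (\<Sum>j\<in>UNIV. dw_A11 (A j) (u0 x t) (limit_w1 A Q u0 x t) *v partial_x j u0 x t)
     + (\<Sum>j\<in>UNIV. deps_A11 (A j) (u0 x t) *v partial_x j u0 x t) = 0"

section \<open>The convection-diffusion system (\<open>d = 1\<close>, \<open>n = 2\<close>, \<open>r = 1\<close>)\<close>

text \<open>\<open>mat c\<close> is the \<open>1 \<times> 1\<close> matrix with entry \<open>c\<close>, and \<open>vec c\<close> the vector in \<open>\<real>\<^sup>1\<close>
  with entry \<open>c\<close>.\<close>

definition cd_A :: "(real \<Rightarrow> real) \<Rightarrow> 1 \<Rightarrow> (1, 1) mat_fun" where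
  "cd_A b j U \<epsilon> = block_matrix (mat 0) (mat 1) (mat (deriv b (upart U $ 1))) (mat 0)"

definition cd_Q :: "(real \<Rightarrow> real) \<Rightarrow> (1, 1) vec_fun" where
  "cd_Q f U \<epsilon> = state 0 (vec (- (wpart U $ 1) + \<epsilon> * f (upart U $ 1)))"

definition cd_A0 :: "(real \<Rightarrow> real) \<Rightarrow> (real \<Rightarrow> real) \<Rightarrow> (1, 1) mat_fun" where
  "cd_A0 f b U \<epsilon> =
     block_matrix (mat (deriv b (upart U $ 1))) (mat (\<epsilon> * deriv f (upart U $ 1)))
                  (mat (\<epsilon> * deriv f (upart U $ 1))) (mat 1)"

definition cd_pos_region ::
  "(real \<Rightarrow> real) \<Rightarrow> (real \<Rightarrow> real) \<Rightarrow> (real^(1+1)) set \<Rightarrow> ((real^(1+1)) \<times> real) set" where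
  "cd_pos_region f b \<Omega> = {(U, \<epsilon>). U \<in> \<Omega> \<and> \<epsilon> \<in> {0..1} \<and>
     \<epsilon> * \<bar>deriv f (upart U $ 1)\<bar> < sqrt (deriv b (upart U $ 1))}"

text \<open>The state space \<open>\<Omega> = \<Omega>u \<times> \<real>\<close> of the system is admissible.\<close>

lemma state_spaces_product:
  fixes I :: "real set"
  assumes "open I" "is_interval I"
  shows "state_spaces {u :: real^1. u $ 1 \<in> I} {U :: real^(1+1). upart U $ 1 \<in> I}"
proof -
  have lin: "linear (\<lambda>u :: real^1. u $ 1)"
    by (auto intro!: linearI)
  have "convex ((\<lambda>u :: real^1. u $ 1) -` I)"
    using assms lin by (intro convex_linear_vimage) (auto simp: is_interval_convex)
  moreover have "open ((\<lambda>u :: real^1. u $ 1) -` I)"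
    by (intro open_vimage assms continuous_intros)
  moreover have "open ((\<lambda>U :: real^(1+1). U $ Inl 1) -` I)"
    by (intro open_vimage assms continuous_intros)
  ultimately show ?thesis
    by (simp add: state_spaces_def state_def upart_def vimage_def)
qed

text \<open>Scalar functions of \<open>(x, t)\<close>, \<open>x \<in> \<real>\<close>, as \<open>\<real>\<^sup>1\<close>-valued functions on \<open>\<real>\<^sup>1 \<times> \<real>\<close>.\<close>

definition lift :: "(real \<Rightarrow> real \<Rightarrow> real) \<Rightarrow> real^1 \<Rightarrow> real \<Rightarrow> real^1" where
  "lift u x t = vec (u (x $ 1) t)"

text \<open>The scalar equations at a point \<open>(x, t)\<close>: the system for \<open>(u, w)\<close>, the system for
  \<open>(u, v)\<close> it comes from, and the convection-diffusion equation.\<close>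

definition scaled_system ::
  "(real \<Rightarrow> real) \<Rightarrow> (real \<Rightarrow> real) \<Rightarrow> real \<Rightarrow>
   (real \<Rightarrow> real \<Rightarrow> real) \<Rightarrow> (real \<Rightarrow> real \<Rightarrow> real) \<Rightarrow> real \<Rightarrow> real \<Rightarrow> bool" where
  "scaled_system f b \<epsilon> u w x t \<longleftrightarrow>
     deriv (\<lambda>s. u x s) t + (1 / \<epsilon>) * deriv (\<lambda>y. w y t) x = 0 \<and>
     deriv (\<lambda>s. w x s) t + (1 / \<epsilon>) * deriv (\<lambda>y. b (u y t)) x
       = - w x t / \<epsilon>\<^sup>2 + f (u x t) / \<epsilon>"

definition original_system ::
  "(real \<Rightarrow> real) \<Rightarrow> (real \<Rightarrow> real) \<Rightarrow> real \<Rightarrow>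
   (real \<Rightarrow> real \<Rightarrow> real) \<Rightarrow> (real \<Rightarrow> real \<Rightarrow> real) \<Rightarrow> real \<Rightarrow> real \<Rightarrow> bool" where
  "original_system f b \<epsilon> u v x t \<longleftrightarrow>
     deriv (\<lambda>s. u x s) t + deriv (\<lambda>y. v y t) x = 0 \<and>
     \<epsilon>\<^sup>2 * deriv (\<lambda>s. v x s) t + deriv (\<lambda>y. b (u y t)) x = - v x t + f (u x t)"

definition convection_diffusion ::
  "(real \<Rightarrow> real) \<Rightarrow> (real \<Rightarrow> real) \<Rightarrow> (real \<Rightarrow> real \<Rightarrow> real) \<Rightarrow> real \<Rightarrow> real \<Rightarrow> bool" where
  "convection_diffusion f b u x t \<longleftrightarrow>
     deriv (\<lambda>s. u x s) t + deriv (\<lambda>y. f (u y t)) x = deriv (deriv (\<lambda>y. b (u y t))) x"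

text \<open>Classical regularity on an open set of points \<open>(x, t)\<close>: \<open>C\<^sup>k\<close> in \<open>x\<close> and \<open>C\<^sup>1\<close> in \<open>t\<close>.\<close>

definition regular :: "nat \<Rightarrow> (real \<times> real) set \<Rightarrow> (real \<Rightarrow> real \<Rightarrow> real) \<Rightarrow> bool" where
  "regular k D u \<longleftrightarrow>
     (\<forall>t. Ck_on k {x. (x, t) \<in> D} (\<lambda>x. u x t)) \<and> (\<forall>x. Ck_on 1 {t. (x, t) \<in> D} (\<lambda>t. u x t))"

end

(* The coefficients are computed on 1 x 1 blocks; at eps = 0 one finds dw q = -1 and
   w1 = f(u) - b'(u) u_x = f(u) - (b(u))_x, so the flux term (w1)_x of the limit equation is
   f(u)_x - b(u)_xx, while the two correction terms vanish because A11 = 0.  Symmetry of A0 A is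
   a direct computation, and det A0 = b' - (eps f')^2 > 0 is exactly the smallness condition. *)
theory Submission
  imports Defs
begin

section \<open>Calculus of \<open>Ck_on\<close> functions\<close>

text \<open>On an open set, agreement on the set is agreement near each point, so both functions
  have exactly the same candidate derivatives there. Since \<open>frechet_derivative\<close> chooses
  among these candidates, the chosen derivatives coincide, and induction on the order applies to
  them.\<close>

lemma Ck_on_cong:
  assumes "open S" "\<And>x. x \<in> S \<Longrightarrow> f x = g x" "Ck_on k S f"
  shows "Ck_on k S g"
  using assms(2,3)
proof (induction k arbitrary: f g)
  case 0
  then show ?case by (metis Ck_on.simps(1) continuous_on_cong)
next
  case (Suc k)
  have D: "(f has_derivative F) (at x) \<longleftrightarrow> (g has_derivative F) (at x)" if "x \<in> S" for x F
    using has_derivative_transform_within_open[of f F x UNIV S g, OF _ assms(1) that]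
      has_derivative_transform_within_open[of g F x UNIV S f, OF _ assms(1) that] Suc.prems(1)
    by metis
  have "frechet_derivative f (at x) = frechet_derivative g (at x)" if "x \<in> S" for x
    using D[OF that] by (simp add: frechet_derivative_def)
  moreover have "g differentiable at x" if "x \<in> S" for x
    using Suc.prems(2) D that unfolding differentiable_def Ck_on.simps by blast
  moreover have "Ck_on k S (\<lambda>x. frechet_derivative g (at x) v)" for v
    by (rule Suc.IH[of "\<lambda>x. frechet_derivative f (at x) v"])
       (use Suc.prems(2) calculation(1) in simp_all)
  ultimately show ?case
    by simp
qed

text \<open>Uniqueness of the derivative identifies any explicit \<open>F x\<close> with the chosen
  \<open>frechet_derivative\<close>. This is how the usual differentiation rules enter the
  inductions below.\<close>

lemma Ck_on_SucI:
  assumes "open S" "\<And>x. x \<in> S \<Longrightarrow> (f has_derivative F x) (at x)"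
    and "\<And>v. Ck_on k S (\<lambda>x. F x v)"
  shows "Ck_on (Suc k) S f"
proof -
  have "Ck_on k S (\<lambda>x. frechet_derivative f (at x) v)" for v
    by (rule Ck_on_cong[OF assms(1) _ assms(3)]) (simp add: frechet_derivative_at[OF assms(2)])
  then show ?thesis
    using assms(2) by (auto simp: differentiable_def)
qed

lemma Ck_on_SucD:
  assumes "Ck_on (Suc k) S f" "x \<in> S"
  shows "(f has_derivative frechet_derivative f (at x)) (at x)"
  using assms by (simp add: frechet_derivative_works)

text \<open>Differentiability gives continuity at order zero; higher orders follow by applying the
  induction hypothesis to the directional derivatives.\<close>

lemma Ck_on_Suc_imp:
  assumes "Ck_on (Suc k) S f"
  shows "Ck_on k S f"
  using assms
proof (induction k arbitrary: f)
  case 0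
  then show ?case
    by (auto intro!: differentiable_imp_continuous_on
        simp: differentiable_on_def differentiable_at_withinI)
next
  case (Suc k)
  note * = Suc.prems[unfolded Ck_on.simps(2)[of "Suc k"]]
  show ?case
    unfolding Ck_on.simps(2)[of k S f]
    by (intro conjI allI Suc.IH *[THEN conjunct1] *[THEN conjunct2, THEN spec])
qed

section \<open>Closure of C^k functions under algebraic operations and linear substitution\<close>

lemma Ck_on_const: "Ck_on k S (\<lambda>x. c)"
  by (induction k arbitrary: c) (simp_all add: frechet_derivative_const)

lemma Ck_on_linear:
  assumes "bounded_linear h" "open S"
  shows "Ck_on k S h"
proof (cases k)
  case 0
  then show ?thesis using assms by (simp add: linear_continuous_on)
next
  case (Suc m)
  show ?thesis unfolding Suc
    by (rule Ck_on_SucI[where F = "\<lambda>_. h"])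
       (auto simp: assms bounded_linear_imp_has_derivative Ck_on_const)
qed

lemma Ck_on_add:
  assumes "open S" "Ck_on k S f" "Ck_on k S g"
  shows "Ck_on k S (\<lambda>x. f x + g x)"
  using assms(2,3)
proof (induction k arbitrary: f g)
  case 0
  then show ?case by (simp add: continuous_on_add)
next
  case (Suc k)
  have "Ck_on k S (\<lambda>x. frechet_derivative f (at x) v + frechet_derivative g (at x) v)" for v
    by (rule Suc.IH) (use Suc.prems in simp_all)
  with has_derivative_add[OF Ck_on_SucD[OF Suc.prems(1)] Ck_on_SucD[OF Suc.prems(2)]]
  show ?case
    by (rule Ck_on_SucI[OF assms(1)])
qed

lemma Ck_on_bounded_linear:
  assumes "open S" "bounded_linear h" "Ck_on k S f"
  shows "Ck_on k S (\<lambda>x. h (f x))"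
  using assms(3)
proof (induction k arbitrary: f)
  case 0
  then show ?case by (simp add: bounded_linear.continuous_on[OF assms(2)])
next
  case (Suc k)
  have "Ck_on k S (\<lambda>x. h (frechet_derivative f (at x) v))" for v
    by (rule Suc.IH) (use Suc.prems in simp)
  with bounded_linear.has_derivative[OF assms(2) Ck_on_SucD[OF Suc.prems]]
  show ?case
    by (rule Ck_on_SucI[OF assms(1)])
qed

text \<open>The product rule leaves the undifferentiated factors \<open>f\<close> and
  \<open>g\<close> next to derivatives of one order less. The induction therefore first lowers the
  order of \<open>f\<close> and \<open>g\<close>.\<close>

lemma Ck_on_scaleR:
  fixes f :: "'a::euclidean_space \<Rightarrow> real"
  assumes "open S" "Ck_on k S f" "Ck_on k S g"
  shows "Ck_on k S (\<lambda>x. f x *\<^sub>R g x)"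
  using assms(2,3)
proof (induction k arbitrary: f g)
  case 0
  then show ?case by (simp add: continuous_on_scaleR)
next
  case (Suc k)
  have "Ck_on k S f" "Ck_on k S g"
    using Suc.prems by (blast intro: Ck_on_Suc_imp)+
  then have "Ck_on k S (\<lambda>x. f x *\<^sub>R frechet_derivative g (at x) v
      + frechet_derivative f (at x) v *\<^sub>R g x)" for v
    by (intro Ck_on_add assms(1) Suc.IH) (use Suc.prems in simp_all)
  with has_derivative_scaleR[OF Ck_on_SucD[OF Suc.prems(1)] Ck_on_SucD[OF Suc.prems(2)]]
  show ?case
    by (rule Ck_on_SucI[OF assms(1)])
qed

text \<open>For a linear inner map the chain rule differentiates \<open>g\<close> in the direction
  \<open>L v\<close>, which does not depend on \<open>x\<close>, so the induction closes without
  products. This suffices here: the coefficients depend on \<open>u\<close> only through a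
  coordinate of \<open>(U, \<epsilon>)\<close>.\<close>

lemma Ck_on_compose_linear:
  assumes "open S" "bounded_linear L" "L ` S \<subseteq> T" "Ck_on k T g"
  shows "Ck_on k S (\<lambda>x. g (L x))"
  using assms(4)
proof (induction k arbitrary: g)
  case 0
  then show ?case
    using assms by (auto intro: continuous_on_compose2 linear_continuous_on)
next
  case (Suc k)
  have D: "((\<lambda>x. g (L x)) has_derivative (\<lambda>v. frechet_derivative g (at (L x)) (L v))) (at x)"
    if "x \<in> S" for x
    by (rule has_derivative_compose[OF bounded_linear_imp_has_derivative[OF assms(2)]
          Ck_on_SucD[OF Suc.prems]]) (use that assms(3) in blast)
  have "Ck_on k S (\<lambda>x. frechet_derivative g (at (L x)) (L v))" for v
    by (rule Suc.IH) (use Suc.prems in simp)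
  with D show ?case
    by (rule Ck_on_SucI[OF assms(1)])
qed

section \<open>Passage between \<open>smooth_on\<close> and C^k, and one-variable
  derivatives\<close>

lemma smooth_onI:
  assumes "open T" "S \<subseteq> T" "\<And>k. Ck_on k T g" "\<And>x. x \<in> S \<Longrightarrow> g x = f x"
  shows "smooth_on S f"
  using assms unfolding smooth_on_def by blast

text \<open>The smooth extension restricts to \<open>S\<close> by composition with the identity map,
  and on the open set \<open>S\<close> it can be replaced by \<open>f\<close> itself.\<close>

lemma smooth_on_openD:
  assumes "open S" "smooth_on S f"
  shows "Ck_on k S f"
proof -
  obtain T g where T: "open T" "S \<subseteq> T" "\<forall>x\<in>S. g x = f x" "\<forall>k. Ck_on k T g"
    using assms(2) by (auto simp: smooth_on_def)
  have "Ck_on k S g"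
    using Ck_on_compose_linear[OF assms(1) bounded_linear_ident, of T k g] T by auto
  with T(3) show ?thesis by (blast intro: Ck_on_cong[OF assms(1)])
qed

lemma Ck_on_Suc_has_field_derivative:
  fixes f :: "real \<Rightarrow> real"
  assumes "Ck_on (Suc k) S f" "x \<in> S"
  shows "(f has_field_derivative deriv f x) (at x)"
  using assms by (simp add: DERIV_deriv_iff_real_differentiable)

text \<open>The one-variable Frechet derivative is multiplication by \<open>deriv f x\<close>, so
  \<open>deriv f\<close> is the directional derivative in direction 1.\<close>

lemma Ck_on_deriv:
  fixes f :: "real \<Rightarrow> real"
  assumes "open S" "Ck_on (Suc k) S f"
  shows "Ck_on k S (deriv f)"
proof (rule Ck_on_cong[OF assms(1)])
  show "Ck_on k S (\<lambda>x. frechet_derivative f (at x) 1)"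
    using assms(2) by simp
  fix x assume "x \<in> S"
  then have "(*) (deriv f x) = frechet_derivative f (at x)"
    by (intro frechet_derivative_at Ck_on_Suc_has_field_derivative[OF assms(2),
          unfolded has_field_derivative_def])
  from fun_cong[OF this, of 1] show "frechet_derivative f (at x) 1 = deriv f x"
    by simp
qed

section \<open>Blocks of size one\<close>

lemma mat_1x1_mult_vec [simp]: "(mat a :: real^1^1) *v vec c = vec (a * c)"
  by (simp add: vec_eq_iff matrix_vector_mult_def mat_def)

lemma upart_state [simp]: "upart (state u w) = u"
  and wpart_state [simp]: "wpart (state u w) = w"
  by (simp_all add: vec_eq_iff upart_def wpart_def state_def)

lemma state_upart_wpart [simp]: "state (upart U) (wpart U) = U"
  by (auto simp: vec_eq_iff upart_def wpart_def state_def split: sum.split)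

lemma block_block_matrix [simp]:
  "block11 (block_matrix a b c d) = a"
  "block12 (block_matrix a b c d) = b"
  "block21 (block_matrix a b c d) = c"
  by (simp_all add: vec_eq_iff block11_def block12_def block21_def block_matrix_def)

text \<open>The index type is a disjoint union of the \<open>u\<close> and \<open>w\<close> indices;
  splitting sums accordingly turns matrix and inner products into blockwise formulas.\<close>

lemma sum_UNIV_sum:
  "(\<Sum>i\<in>UNIV. F i) = (\<Sum>a\<in>UNIV. F (Inl a)) + (\<Sum>a\<in>UNIV. F (Inr a :: 'a::finite + 'b::finite))"
  unfolding UNIV_Plus_UNIV[symmetric] by (subst sum.Plus) auto

lemma transpose_0 [simp]: "transpose 0 = 0"
  by (simp add: vec_eq_iff transpose_def)

lemma block_matrix_mult_state:
  "block_matrix a b c d *v state u w = state (a *v u + b *v w) (c *v u + d *v w)"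
  by (auto simp: vec_eq_iff matrix_vector_mult_def block_matrix_def state_def sum_UNIV_sum
      split: sum.split)

lemma inner_state: "state u w \<bullet> state u' w' = u \<bullet> u' + w \<bullet> w'"
  by (simp add: inner_vec_def state_def sum_UNIV_sum)

lemma block_matrix_mult:
  "block_matrix a b c d ** block_matrix a' b' c' d' =
     block_matrix (a ** a' + b ** c') (a ** b' + b ** d') (c ** a' + d ** c') (c ** b' + d ** d')"
  by (auto simp: vec_eq_iff matrix_matrix_mult_def block_matrix_def sum_UNIV_sum split: sum.split)

lemma transpose_block_matrix:
  "transpose (block_matrix a b c d) =
     block_matrix (transpose a) (transpose c) (transpose b) (transpose d)"
  by (auto simp: vec_eq_iff transpose_def block_matrix_def split: sum.split)

lemma block_matrix_add:
  "block_matrix a b c d + block_matrix a' b' c' d' =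
     block_matrix (a + a') (b + b') (c + c') (d + d')"
  by (auto simp: vec_eq_iff block_matrix_def split: sum.split)

lemma block_matrix_minus:
  "- block_matrix a b c d = block_matrix (- a) (- b) (- c) (- d)"
  by (auto simp: vec_eq_iff block_matrix_def split: sum.split)

lemma mat_1x1_mult [simp]: "(mat a :: real^1^1) ** mat c = mat (a * c)"
  by (simp add: vec_eq_iff matrix_matrix_mult_def mat_def)

lemma mat_1x1_add [simp]: "(mat a :: real^1^1) + mat c = mat (a + c)"
  by (simp add: vec_eq_iff mat_def)

lemma mat_1x1_minus [simp]: "- (mat a :: real^1^1) = mat (- a)"
  by (simp add: vec_eq_iff mat_def)

text \<open>For square matrices a one-sided inverse is two-sided, so the matrix chosen by
  \<open>matrix_inv\<close> is a genuine left inverse of \<open>A\<close>; multiplying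
  \<open>A ** B = mat 1\<close> by it on the left gives the claim.\<close>

lemma matrix_inv_eq:
  fixes A B :: "real^'n^'n"
  assumes "A ** B = mat 1"
  shows "matrix_inv A = B"
proof -
  have "\<exists>B. A ** B = mat 1 \<and> B ** A = mat 1"
    using assms matrix_left_right_inverse by blast
  then have "matrix_inv A ** A = mat 1"
    unfolding matrix_inv_def by (rule someI2_ex) simp
  then show ?thesis
    by (metis assms matrix_mul_assoc matrix_mul_lid matrix_mul_rid)
qed

section \<open>Linear maps between scalars and states, and transfer of derivatives along
  them\<close>

lemma bounded_linear_upart_1: "bounded_linear (\<lambda>U :: real^(1+1). upart U $ 1)"
  and bounded_linear_wpart_1: "bounded_linear (\<lambda>U :: real^(1+1). wpart U $ 1)"
  by (simp_all add: upart_def wpart_def bounded_linear_vec_nth)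

lemma bounded_linear_state_vec:
  "bounded_linear (\<lambda>z. state (vec (fst z)) (vec (snd z)) :: real^(1+1))"
  by (rule linear_conv_bounded_linear[THEN iffD1], rule linearI)
     (auto simp: vec_eq_iff state_def split: sum.split)

lemma bounded_linear_vec_1: "bounded_linear (vec :: real \<Rightarrow> real^1)"
  by (rule linear_conv_bounded_linear[THEN iffD1], rule linearI) (auto simp: vec_eq_iff)

lemma has_vector_derivative_vec:
  assumes "(g has_real_derivative g') (at x within S)"
  shows "((\<lambda>s. vec (g s) :: real^1) has_vector_derivative vec g') (at x within S)"
  using bounded_linear.has_vector_derivative[OF bounded_linear_vec_1] assms
  by (simp add: has_real_derivative_iff_has_vector_derivative)

lemma has_vector_derivative_state_vec:
  assumes "(g has_real_derivative g') (at x within S)" "(h has_real_derivative h') (at x within S)"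
  shows "((\<lambda>s. state (vec (g s)) (vec (h s)) :: real^(1+1)) has_vector_derivative
           state (vec g') (vec h')) (at x within S)"
  using bounded_linear.has_vector_derivative[OF bounded_linear_state_vec
      has_vector_derivative_Pair[OF assms[unfolded has_real_derivative_iff_has_vector_derivative]]]
  by simp

section \<open>The coefficients of the convection-diffusion system\<close>

lemma cd_A_state:
  "cd_A b j (state (vec u) w) \<epsilon> = block_matrix (mat 0) (mat 1) (mat (deriv b u)) (mat 0)"
  by (simp add: cd_A_def)

lemma q_of_cd_Q: "q_of (cd_Q f) U \<epsilon> = vec (- (wpart U $ 1) + \<epsilon> * f (upart U $ 1))"
  by (simp add: q_of_def cd_Q_def)

lemma dw_q_cd_Q: "dw_q (cd_Q f) u = mat (- 1)"
proof -
  \<comment> \<open>At \<epsilon> = 0 the term with \<open>f\<close> disappears and the source is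
    exactly -w, hence linear in \<open>w\<close>.\<close>
  have "(\<lambda>w. q_of (cd_Q f) (state u w) 0) = uminus"
    by (auto simp: q_of_cd_Q vec_eq_iff)
  moreover have "frechet_derivative uminus (at (0 :: real^1)) = uminus"
    by (rule frechet_derivative_at[symmetric]) (auto intro!: derivative_eq_intros)
  ultimately show ?thesis
    by (simp add: dw_q_def vec_eq_iff matrix_def mat_def axis_def)
qed

text \<open>The parameter value 0 is an endpoint of [0,1], but one-sided derivatives on a
  nondegenerate interval are unique, so the two-sided derivative is the value.\<close>

lemma vector_derivative_within_01:
  assumes "(g has_vector_derivative g') (at 0)"
  shows "vector_derivative g (at 0 within {0..1::real}) = g'"
  using assms vector_derivative_within_cbox[of 0 1 0 g g']
  by (simp add: has_vector_derivative_at_within)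

lemma deps_q_cd_Q: "deps_q (cd_Q f) (vec u) = vec (f u)"
  unfolding deps_q_def q_of_cd_Q
  by (rule vector_derivative_within_01, rule has_vector_derivative_vec)
     (auto intro!: derivative_eq_intros)

lemma dU_Q_cd_Q: "dU_Q (cd_Q f) u = block_matrix (mat 0) (mat 0) (mat 0) (mat (- 1))"
proof -
  \<comment> \<open>With \<epsilon> = 0 the whole source is linear in \<open>U\<close>, so it is its
    own derivative and its matrix can be read off on the basis vectors.\<close>
  have "bounded_linear (\<lambda>U. cd_Q f U 0)"
    by (rule linear_conv_bounded_linear[THEN iffD1], rule linearI)
       (auto simp: cd_Q_def vec_eq_iff state_def wpart_def split: sum.split)
  then have "frechet_derivative (\<lambda>U. cd_Q f U 0) (at (state u 0)) = (\<lambda>U. cd_Q f U 0)"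
    by (metis bounded_linear_imp_has_derivative frechet_derivative_at)
  then show ?thesis
    by (auto simp: dU_Q_def vec_eq_iff matrix_def mat_def axis_def block_matrix_def cd_Q_def
        state_def wpart_def split: sum.split)
qed

lemma dw_A11_cd_A: "dw_A11 (cd_A b j) u w1 = 0"
  by (simp add: dw_A11_def cd_A_def frechet_derivative_const)

lemma deps_A11_cd_A: "deps_A11 (cd_A b j) u = 0"
  unfolding deps_A11_def cd_A_def by (intro vector_derivative_within_01) simp

section \<open>Verification of criteria (ii) to (v)\<close>

lemma criterion_ii_cd: "criterion_ii \<Omega>u \<Omega> (cd_Q f)"
  unfolding criterion_ii_def
proof (intro conjI allI ballI impI)
  fix u :: "real^1"
  show "invertible (dw_q (cd_Q f) u)"
    unfolding dw_q_cd_Q invertible_def by (intro exI[of _ "mat (- 1)"]) simp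
qed (auto simp: q_of_cd_Q vec_eq_iff)

text \<open>Completing the square in \<open>y\<close> leaves the coefficient a - c^2 in front of
  x^2. It is the determinant of the form and is positive because |c| < sqrt a; for x = 0 only y^2
  remains.\<close>

lemma binary_quadratic_form_pos:
  fixes a c x y :: real
  assumes "a > 0" "\<bar>c\<bar> < sqrt a" "x \<noteq> 0 \<or> y \<noteq> 0"
  shows "a * x\<^sup>2 + 2 * c * x * y + y\<^sup>2 > 0"
proof -
  have "c\<^sup>2 < a"
    using assms(1,2) by (simp add: real_less_rsqrt abs_less_iff flip: real_sqrt_abs)
  have eq: "a * x\<^sup>2 + 2 * c * x * y + y\<^sup>2 = (a - c\<^sup>2) * x\<^sup>2 + (y + c * x)\<^sup>2"
    by (simp add: power2_eq_square algebra_simps)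
  show ?thesis
  proof (cases "x = 0")
    case False
    then show ?thesis
      unfolding eq using \<open>c\<^sup>2 < a\<close> by (intro add_pos_nonneg) auto
  qed (use assms(3) in auto)
qed

lemma criterion_iii_cd:
  assumes "\<And>U. U \<in> \<Omega> \<Longrightarrow> deriv b (upart U $ 1) > 0"
  shows "criterion_iii \<Omega> (cd_pos_region f b \<Omega>) (cd_A b) (cd_A0 f b)"
  unfolding criterion_iii_def
proof (intro ballI conjI impI allI)
  fix U \<epsilon> assume U: "U \<in> \<Omega>" "\<epsilon> \<in> {0..1 :: real}"
  show "sym_matrix (cd_A0 f b U \<epsilon>)"
    by (simp add: sym_matrix_def cd_A0_def transpose_block_matrix)
  \<comment> \<open>Both products have diagonal entries \<epsilon> f' b' and \<epsilon> f' and
    off-diagonal entries b'; no smallness of \<epsilon> enters.\<close>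
  show "cd_A0 f b U \<epsilon> ** cd_A b j U \<epsilon> = transpose (cd_A b j U \<epsilon>) ** cd_A0 f b U \<epsilon>" for j
    by (simp add: cd_A0_def cd_A_def transpose_block_matrix block_matrix_mult mult.commute)
  assume P: "(U, \<epsilon>) \<in> cd_pos_region f b \<Omega>"
  let ?b = "deriv b (upart U $ 1)" and ?f = "\<epsilon> * deriv f (upart U $ 1)"
  show "pos_def (cd_A0 f b U \<epsilon>)"
    unfolding pos_def_def
  proof (intro allI impI)
    fix X :: "real^(1+1)" assume "X \<noteq> 0"
    define x y where "x = upart X $ 1" and "y = wpart X $ 1"
    have X: "X = state (vec x) (vec y)"
      by (simp add: x_def y_def)
    have "X = 0" if "x = 0" "y = 0"
      unfolding X that by (simp add: vec_eq_iff state_def split: sum.split)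
    then have "x \<noteq> 0 \<or> y \<noteq> 0"
      using \<open>X \<noteq> 0\<close> by blast
    \<comment> \<open>This is the defining inequality of \<open>cd_pos_region\<close>, with
      \<epsilon> moved inside the absolute value since it is nonnegative.\<close>
    moreover have "\<bar>?f\<bar> < sqrt ?b"
      using P U by (auto simp: cd_pos_region_def abs_mult)
    ultimately have "?b * x\<^sup>2 + 2 * ?f * x * y + y\<^sup>2 > 0"
      using assms[OF U(1)] by (intro binary_quadratic_form_pos)
    also have "?b * x\<^sup>2 + 2 * ?f * x * y + y\<^sup>2 = X \<bullet> (cd_A0 f b U \<epsilon> *v X)"
      by (simp add: X cd_A0_def block_matrix_mult_state inner_state)
         (simp add: inner_vec_def power2_eq_square algebra_simps)
    finally show "X \<bullet> (cd_A0 f b U \<epsilon> *v X) > 0" .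
  qed
qed

lemma criterion_iv_cd: "criterion_iv \<Omega>u (cd_Q f) (cd_A0 f b)"
  unfolding criterion_iv_def
\<comment> \<open>At \<epsilon> = 0 the symmetrizer is diag(b', 1) and the Jacobian of the source is
  diag(0, -1), so the symmetrized product is diag(0, -2). The choice S = 2 turns the required
  inequality into an equality.\<close>
proof (intro exI[of _ "\<lambda>_. mat 2"] ballI conjI)
  show "sym_matrix (mat 2 :: real^1^1)"
    by (simp add: sym_matrix_def)
  show "pos_def (mat 2 :: real^1^1)"
    by (auto simp: pos_def_def inner_vec_def matrix_vector_mult_def mat_def vec_eq_iff)
       (metis not_square_less_zero mult_eq_0_iff linorder_neqE)
  fix u :: "real^1"
  show "loewner_le
      (cd_A0 f b (state u 0) 0 ** dU_Q (cd_Q f) u + transpose (dU_Q (cd_Q f) u) ** cd_A0 f b (state u 0) 0)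
      (- block_matrix 0 0 0 (mat 2))"
    by (simp add: loewner_le_def cd_A0_def dU_Q_cd_Q transpose_block_matrix block_matrix_mult
        block_matrix_add block_matrix_minus)
qed

lemma criterion_v_cd: "criterion_v \<Omega>u (cd_A b)"
  by (simp add: criterion_v_def cd_A_def vec_eq_iff mat_def)

text \<open>The scalar -w + \<epsilon> f(u) is built from linear coordinates, one composition with
  \<open>f\<close> and one product. The linear map \<open>h\<close> is left free so that the same
  argument serves both \<open>Q\<close> and its second component \<open>q\<close>.\<close>

lemma smooth_on_q_cd:
  assumes "open I" "smooth_on I f" "\<And>U. U \<in> \<Omega> \<Longrightarrow> upart U $ 1 \<in> I"
    and "bounded_linear h"
  shows "smooth_on (\<Omega> \<times> {0..1})
           (\<lambda>(U :: real^(1+1), \<epsilon>). h (- (wpart U $ 1) + \<epsilon> * f (upart U $ 1)))"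
proof -
  let ?L = "\<lambda>p :: (real^(1+1)) \<times> real. upart (fst p) $ 1"
  \<comment> \<open>An open neighbourhood on which the formula still makes sense: \<epsilon> may be
    any real number, and only the \<open>u\<close> coordinate is restricted, to the domain of
    \<open>f\<close>.\<close>
  let ?T = "?L -` I"
  have L: "bounded_linear ?L"
    by (rule bounded_linear_compose[OF bounded_linear_upart_1 bounded_linear_fst])
  have T: "open ?T"
    by (intro open_vimage assms(1) linear_continuous_on[OF L])
  have W: "bounded_linear (\<lambda>p :: (real^(1+1)) \<times> real. - (wpart (fst p) $ 1))"
    by (intro bounded_linear_minus
        bounded_linear_compose[OF bounded_linear_wpart_1 bounded_linear_fst])
  have "Ck_on k ?T (\<lambda>p. f (?L p))" for k
    by (rule Ck_on_compose_linear[OF T L _ smooth_on_openD[OF assms(1,2)]]) auto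
  then have "Ck_on k ?T (\<lambda>p. - (wpart (fst p) $ 1) + snd p *\<^sub>R f (?L p))" for k
    by (rule Ck_on_add[OF T Ck_on_linear[OF W T]
          Ck_on_scaleR[OF T Ck_on_linear[OF bounded_linear_snd T]]])
  from Ck_on_bounded_linear[OF T assms(4) this] show ?thesis
    by (rule smooth_onI[OF T, rotated]) (use assms(3) in auto)
qed

lemma smooth_coefficients_cd:
  assumes "open I" "smooth_on I f" "smooth_on I b" "\<And>U. U \<in> \<Omega> \<Longrightarrow> upart U $ 1 \<in> I"
  shows "smooth_coefficients \<Omega> (cd_A b) (cd_Q f)"
  unfolding smooth_coefficients_def
proof (intro conjI allI)
  fix j :: 1
  let ?L = "\<lambda>p :: (real^(1+1)) \<times> real. upart (fst p) $ 1"
  let ?T = "?L -` I"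
  \<comment> \<open>The coefficient matrix is affine in b'(u): \<open>?h\<close> embeds the lower
    left entry linearly, and the constant upper right entry is added afterwards.\<close>
  let ?h = "\<lambda>r. block_matrix 0 0 (mat r) 0 :: real^(1+1)^(1+1)"
  have L: "bounded_linear ?L"
    by (rule bounded_linear_compose[OF bounded_linear_upart_1 bounded_linear_fst])
  have T: "open ?T"
    by (intro open_vimage assms(1) linear_continuous_on[OF L])
  have h: "bounded_linear ?h"
    by (rule linear_conv_bounded_linear[THEN iffD1], rule linearI)
       (auto simp: vec_eq_iff block_matrix_def mat_def split: sum.split)
  have "Ck_on k ?T (\<lambda>p. deriv b (?L p))" for k
    by (rule Ck_on_compose_linear[OF T L _ Ck_on_deriv[OF assms(1) smooth_on_openD[OF assms(1,3)]]])
       auto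
  then have "Ck_on k ?T (\<lambda>p. ?h (deriv b (?L p)) + block_matrix 0 (mat 1) 0 0)" for k
    by (rule Ck_on_add[OF T Ck_on_bounded_linear[OF T h] Ck_on_const])
  moreover have "cd_A b j U \<epsilon> = ?h (deriv b (upart U $ 1)) + block_matrix 0 (mat 1) 0 0" for U \<epsilon>
    by (auto simp: cd_A_def block_matrix_add vec_eq_iff block_matrix_def mat_def split: sum.split)
  ultimately show "smooth_on (\<Omega> \<times> {0..1}) (\<lambda>(U, \<epsilon>). cd_A b j U \<epsilon>)"
    by (intro smooth_onI[OF T, of _ "\<lambda>p. ?h (deriv b (?L p)) + block_matrix 0 (mat 1) 0 0"])
       (use assms(4) in auto)
next
  have "bounded_linear (\<lambda>r. state 0 (vec r) :: real^(1+1))"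
    by (rule linear_conv_bounded_linear[THEN iffD1], rule linearI)
       (auto simp: vec_eq_iff state_def split: sum.split)
  from smooth_on_q_cd[OF assms(1,2,4) this]
  show "smooth_on (\<Omega> \<times> {0..1}) (\<lambda>(U, \<epsilon>). cd_Q f U \<epsilon>)"
    by (simp add: cd_Q_def)
qed

lemma criterion_i_cd:
  assumes "open I" "smooth_on I f" "\<And>U. U \<in> \<Omega> \<Longrightarrow> upart U $ 1 \<in> I"
  shows "criterion_i \<Omega> (cd_Q f)"
  unfolding criterion_i_def q_of_cd_Q
proof
  show "smooth_on (\<Omega> \<times> {0..1})
      (\<lambda>(U, \<epsilon>). vec (- (wpart U $ 1) + \<epsilon> * f (upart U $ 1)) :: real^1)"
    by (rule smooth_on_q_cd[OF assms bounded_linear_vec_1])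
qed (simp add: cd_Q_def)

section \<open>The equations\<close>

lemma regular_D:
  assumes "regular (Suc k) D u" "(x, t) \<in> D"
  shows "((\<lambda>y. u y t) has_real_derivative deriv (\<lambda>y. u y t) x) (at x)"
    and "((\<lambda>s. u x s) has_real_derivative deriv (\<lambda>s. u x s) t) (at t)"
proof -
  have 1: "Ck_on (Suc k) {y. (y, t) \<in> D} (\<lambda>y. u y t)"
    and 2: "Ck_on (Suc 0) {s. (x, s) \<in> D} (\<lambda>s. u x s)"
    using assms(1) unfolding regular_def One_nat_def by blast+
  show "((\<lambda>y. u y t) has_real_derivative deriv (\<lambda>y. u y t) x) (at x)"
    by (rule Ck_on_Suc_has_field_derivative[OF 1]) (simp add: assms(2))
  show "((\<lambda>s. u x s) has_real_derivative deriv (\<lambda>s. u x s) t) (at t)"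
    by (rule Ck_on_Suc_has_field_derivative[OF 2]) (simp add: assms(2))
qed

lemma open_slice:
  assumes "open (D :: (real \<times> real) set)"
  shows "open {y. (y, t) \<in> D}"
proof -
  have "open ((\<lambda>y. (y, t)) -` D)"
    by (intro open_vimage assms continuous_intros)
  then show ?thesis by (simp add: vimage_def)
qed

lemma DERIV_shift_0:
  assumes "(g has_real_derivative g') (at x)"
  shows "((\<lambda>s. g (x + s)) has_real_derivative g') (at 0)"
  using assms DERIV_shift[of g g' 0 x] by (simp add: add.commute)

lemma vec_plus_axis_1: "(vec x + s *\<^sub>R axis j 1) = (vec (x + s) :: real^1)"
  by (simp add: vec_eq_iff axis_def)

text \<open>In \<open>real^1\<close> a displacement along the only axis is a shift of the scalar
  argument, so \<open>partial_x\<close> reduces to an ordinary derivative of the single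
  component.\<close>

lemma partial_x_vec:
  assumes "((\<lambda>y. g (vec y) t $ 1) has_real_derivative g') (at x)"
  shows "partial_x j (g :: real^1 \<Rightarrow> real \<Rightarrow> real^1) (vec x) t = vec g'"
  using has_vector_derivative_vec[OF DERIV_shift_0[OF assms]]
  by (simp add: partial_x_def vec_plus_axis_1 vector_derivative_at)

lemma system_equation_cd:
  assumes "\<epsilon> > 0" "(b has_real_derivative deriv b (u x t)) (at (u x t))"
    and "((\<lambda>y. u y t) has_real_derivative ux) (at x)" "((\<lambda>s. u x s) has_real_derivative ut) (at t)"
    and "((\<lambda>y. w y t) has_real_derivative wx) (at x)" "((\<lambda>s. w x s) has_real_derivative wt) (at t)"
  shows "system_equation (cd_A b) (cd_Q f) \<epsilon> (\<lambda>y s. state (lift u y s) (lift w y s)) (vec x) t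
           \<longleftrightarrow> scaled_system f b \<epsilon> u w x t"
proof -
  let ?U = "\<lambda>y s. state (lift u y s) (lift w y s)"
  have px: "partial_x j ?U (vec x) t = state (vec ux) (vec wx)" for j
    using has_vector_derivative_state_vec[OF assms(3,5)[THEN DERIV_shift_0]]
    by (simp add: partial_x_def vec_plus_axis_1 lift_def vector_derivative_at)
  have pt: "partial_t ?U (vec x) t = state (vec ut) (vec wt)"
    using has_vector_derivative_state_vec[OF assms(4,6)]
    by (simp add: partial_t_def lift_def vector_derivative_at)
  have bu: "deriv (\<lambda>y. b (u y t)) x = deriv b (u x t) * ux"
    using DERIV_chain2[OF assms(2,3)] by (rule DERIV_imp_deriv)
  \<comment> \<open>Injectivity splits the vector equation into its two scalar components.\<close>
  have inj: "state (vec p) (vec q) = state (vec r) (vec s) \<longleftrightarrow> p = r \<and> q = s"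
    for p q r s :: real
    by (metis upart_state wpart_state vec_component)
  have lin: "state (vec p) (vec q) + c *\<^sub>R state (vec r) (vec s)
      = (state (vec (p + c * r)) (vec (q + c * s)) :: real^(1+1))" for p q r s c :: real
    by (auto simp: vec_eq_iff state_def split: sum.split)
  have sum1: "(\<Sum>j\<in>(UNIV :: 1 set). c) = c" for c :: "real^(1+1)"
    by simp
  have Q0: "cd_Q f (?U (vec x) t) \<epsilon> = state 0 (vec (- w x t + \<epsilon> * f (u x t)))"
    by (simp add: cd_Q_def lift_def)
  have Q: "(1 / \<epsilon>\<^sup>2) *\<^sub>R cd_Q f (?U (vec x) t) \<epsilon>
      = state (vec 0) (vec (- w x t / \<epsilon>\<^sup>2 + f (u x t) / \<epsilon>))"
    unfolding Q0 using assms(1)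
    by (auto simp: vec_eq_iff state_def field_simps power2_eq_square split: sum.split)
  have A: "cd_A b j (?U (vec x) t) \<epsilon> *v state (vec ux) (vec wx)
      = state (vec wx) (vec (deriv b (u x t) * ux))" for j
    by (simp add: lift_def cd_A_state block_matrix_mult_state)
  show ?thesis
    unfolding system_equation_def scaled_system_def px pt bu A Q
      DERIV_imp_deriv[OF assms(4)] DERIV_imp_deriv[OF assms(5)] DERIV_imp_deriv[OF assms(6)]
      sum1 lin inj
    by simp
qed

text \<open>With w = \<epsilon> v the factor \<epsilon> cancels in the first equation, and
  multiplying the second by \<epsilon> gives the unscaled form; \<epsilon> > 0 makes this
  reversible.\<close>

lemma scaled_system_iff_original_system:
  assumes "\<epsilon> > 0"
    and "((\<lambda>y. v y t) has_real_derivative vx) (at x)" "((\<lambda>s. v x s) has_real_derivative vt) (at t)"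
  shows "scaled_system f b \<epsilon> u (\<lambda>y s. \<epsilon> * v y s) x t \<longleftrightarrow> original_system f b \<epsilon> u v x t"
proof -
  have d: "deriv (\<lambda>y. \<epsilon> * v y t) x = \<epsilon> * vx" "deriv (\<lambda>s. \<epsilon> * v x s) t = \<epsilon> * vt"
    "deriv (\<lambda>y. v y t) x = vx" "deriv (\<lambda>s. v x s) t = vt"
    using assms(2,3) by (auto intro!: DERIV_imp_deriv derivative_eq_intros)
  show ?thesis
    using assms(1) unfolding scaled_system_def original_system_def d
    by (auto simp: field_simps power2_eq_square)
qed

text \<open>Here \<open>dw_q\<close> is -1, its own inverse, which flips the sign of b'(u) u_x -
  f(u).\<close>

lemma limit_w1_cd:
  assumes "((\<lambda>y. u y t) has_real_derivative ux) (at x)"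
  shows "limit_w1 (cd_A b) (cd_Q f) (lift u) (vec x) t = vec (f (u x t) - deriv b (u x t) * ux)"
proof -
  have "partial_x j (lift u) (vec x) t = vec ux" for j
    by (rule partial_x_vec) (use assms in \<open>simp add: lift_def\<close>)
  moreover have "matrix_inv (mat (- 1) :: real^1^1) = mat (- 1)"
    by (rule matrix_inv_eq) simp
  moreover have "vec p - vec q = (vec (p - q) :: real^1)" for p q :: real
    by (simp add: vec_eq_iff)
  ultimately show ?thesis
    by (simp add: limit_w1_def dw_q_cd_Q deps_q_cd_Q lift_def cd_A_state)
qed

lemma limit_equation_cd:
  assumes "open I" "smooth_on I f" "smooth_on I b"
    and D: "open D" "regular 2 D u" "\<forall>(y, s)\<in>D. u y s \<in> I" "(x, t) \<in> D"
  shows "limit_equation (cd_A b) (cd_Q f) (lift u) (vec x) t \<longleftrightarrow> convection_diffusion f b u x t"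
proof -
  define S where "S = {y. (y, t) \<in> D}"
  have S: "open S" "x \<in> S"
    using open_slice[OF D(1)] D(4) by (auto simp: S_def)
  have reg: "regular (Suc (Suc 0)) D u"
    using D(2) by (simp add: numeral_2_eq_2)
  define ux where "ux = deriv (\<lambda>y. u y t)"
  have ux: "((\<lambda>y. u y t) has_real_derivative ux y) (at y)" if "y \<in> S" for y
    using regular_D(1)[OF reg, of y t] that by (simp add: S_def ux_def)
  \<comment> \<open>Two orders in x are needed because \<open>limit_w1\<close> already contains u_x
    and is differentiated once more.\<close>
  have "Ck_on (Suc (Suc 0)) S (\<lambda>y. u y t)"
    using reg unfolding regular_def S_def by blast
  then have uxx: "(ux has_real_derivative deriv ux x) (at x)"
    unfolding ux_def using S by (intro Ck_on_Suc_has_field_derivative Ck_on_deriv)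
  have uI: "u y t \<in> I" if "y \<in> S" for y
    using D(3) that by (auto simp: S_def)
  have f: "(f has_real_derivative deriv f z) (at z)" if "z \<in> I" for z
    using that by (rule Ck_on_Suc_has_field_derivative[OF smooth_on_openD[OF assms(1,2)]])
  have b: "(b has_real_derivative deriv b z) (at z)" if "z \<in> I" for z
    using that by (rule Ck_on_Suc_has_field_derivative[OF smooth_on_openD[OF assms(1,3)]])
  have b': "(deriv b has_real_derivative deriv (deriv b) z) (at z)" if "z \<in> I" for z
    using that by (rule Ck_on_Suc_has_field_derivative[OF
          Ck_on_deriv[OF assms(1) smooth_on_openD[OF assms(1,3)]]])
  define bx where "bx = (\<lambda>y. deriv b (u y t) * ux y)"
  have bx: "deriv (\<lambda>y. b (u y t)) y = bx y" if "y \<in> S" for y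
    unfolding bx_def using DERIV_chain2[OF b[OF uI[OF that]] ux[OF that]] by (rule DERIV_imp_deriv)
  note bxx' = DERIV_mult[OF DERIV_chain2[OF b'[OF uI[OF S(2)]] ux[OF S(2)]] uxx]
  have bxx: "(bx has_real_derivative deriv bx x) (at x)"
    unfolding bx_def using bxx' DERIV_imp_deriv[OF bxx'] by simp
  \<comment> \<open>The chain rule formula for the first derivative is known only on the slice
    \<open>S\<close>; openness of \<open>S\<close> makes this agreement near \<open>x\<close>,
    enough to differentiate again.\<close>
  have bxx_eq: "deriv (deriv (\<lambda>y. b (u y t))) x = deriv bx x"
    using S bx by (intro deriv_cong_ev) (auto simp: eventually_nhds)
  note fx' = DERIV_chain2[OF f[OF uI[OF S(2)]] ux[OF S(2)]]
  have fx: "((\<lambda>y. f (u y t)) has_real_derivative deriv (\<lambda>y. f (u y t)) x) (at x)"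
    using fx' DERIV_imp_deriv[OF fx'] by simp
  let ?w1 = "limit_w1 (cd_A b) (cd_Q f) (lift u)"
  have w1: "?w1 (vec y) t $ 1 = f (u y t) - bx y" if "y \<in> S" for y
    using limit_w1_cd[where u = u and t = t, OF ux[OF that]] by (simp add: bx_def)
  \<comment> \<open>The explicit form of \<open>?w1\<close> likewise holds on the open slice, so its
    derivative at \<open>x\<close> is that of f(u) - (b(u))_x.\<close>
  have "((\<lambda>y. ?w1 (vec y) t $ 1) has_real_derivative
      deriv (\<lambda>y. f (u y t)) x - deriv bx x) (at x)"
    using has_field_derivative_transform_within_open[OF DERIV_diff[OF fx bxx] S] w1 by simp
  then have w1x: "partial_x j ?w1 (vec x) t = vec (deriv (\<lambda>y. f (u y t)) x - deriv bx x)" for j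
    by (rule partial_x_vec)
  have ut: "partial_t (lift u) (vec x) t = vec (deriv (\<lambda>s. u x s) t)"
    using has_vector_derivative_vec[OF regular_D(2)[OF reg D(4)]]
    by (simp add: partial_t_def lift_def vector_derivative_at)
  have A12: "block12 (cd_A b j (state (lift u (vec x) t) 0) 0) = mat 1" for j
    by (simp add: lift_def cd_A_state)
  have "vec p + vec q = (0 :: real^1) \<longleftrightarrow> p + q = 0" for p q :: real
    by (simp add: vec_eq_iff)
  then show ?thesis
    unfolding limit_equation_def convection_diffusion_def
    by (simp add: A12 ut w1x dw_A11_cd_A deps_A11_cd_A bxx_eq) (simp add: algebra_simps)
qed

theorem mainTheorem3:
  fixes f b :: "real \<Rightarrow> real" and I :: "real set"
    and \<Omega>u :: "(real^1) set" and \<Omega> :: "(real^(1+1)) set"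
  assumes "open I" and "is_interval I"
    and "smooth_on I f" and "smooth_on I b"
    and "\<forall>u\<in>I. deriv b u > 0"
    and "\<Omega>u = {u. u $ 1 \<in> I}"
    and "state_spaces \<Omega>u \<Omega>"
  shows "smooth_coefficients \<Omega> (cd_A b) (cd_Q f)
    \<and> (\<forall>\<epsilon> D u w x t. 0 < \<epsilon> \<and> \<epsilon> \<le> 1 \<and> open D \<and> regular 1 D u \<and> regular 1 D w
          \<and> (\<forall>(y, s)\<in>D. state (vec (u y s)) (vec (w y s)) \<in> \<Omega>) \<and> (x, t) \<in> D \<longrightarrow>
        (system_equation (cd_A b) (cd_Q f) \<epsilon> (\<lambda>y s. state (lift u y s) (lift w y s)) (vec x) t
           \<longleftrightarrow> scaled_system f b \<epsilon> u w x t))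
    \<and> (\<forall>\<epsilon> D u v x t. 0 < \<epsilon> \<and> \<epsilon> \<le> 1 \<and> open D \<and> regular 1 D u \<and> regular 1 D v
          \<and> (\<forall>(y, s)\<in>D. u y s \<in> I) \<and> (x, t) \<in> D \<longrightarrow>
        (scaled_system f b \<epsilon> u (\<lambda>y s. \<epsilon> * v y s) x t \<longleftrightarrow> original_system f b \<epsilon> u v x t))
    \<and> criterion_i \<Omega> (cd_Q f)
    \<and> criterion_ii \<Omega>u \<Omega> (cd_Q f)
    \<and> criterion_iii \<Omega> (cd_pos_region f b \<Omega>) (cd_A b) (cd_A0 f b)
    \<and> criterion_iv \<Omega>u (cd_Q f) (cd_A0 f b)
    \<and> criterion_v \<Omega>u (cd_A b)
    \<and> (\<forall>D u x t. open D \<and> regular 2 D u \<and> (\<forall>(y, s)\<in>D. u y s \<in> I) \<and> (x, t) \<in> D \<longrightarrow>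
        (limit_equation (cd_A b) (cd_Q f) (lift u) (vec x) t \<longleftrightarrow> convection_diffusion f b u x t))"
proof -
  \<comment> \<open>Every \<open>U\<close> is the state of its two parts, so admissibility of the
    state spaces puts its \<open>u\<close> part into \<open>\<Omega>u\<close>.\<close>
  have \<Omega>: "upart U $ 1 \<in> I" if "U \<in> \<Omega>" for U
    using assms(6,7) that unfolding state_spaces_def
    by (metis mem_Collect_eq state_upart_wpart)
  have sys: "system_equation (cd_A b) (cd_Q f) \<epsilon> (\<lambda>y s. state (lift u y s) (lift w y s)) (vec x) t
      \<longleftrightarrow> scaled_system f b \<epsilon> u w x t"
    if "0 < \<epsilon>" "regular 1 D u" "regular 1 D w"
      "\<forall>(y, s)\<in>D. state (vec (u y s)) (vec (w y s)) \<in> \<Omega>" "(x, t) \<in> D"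
    for \<epsilon> D u w x t
  proof -
    \<comment> \<open>Solutions with values in \<Omega> have \<open>u\<close> in the domain of
      \<open>b\<close>, where the chain rule for b(u) is available.\<close>
    have uI: "u x t \<in> I"
      using \<Omega>[of "state (vec (u x t)) (vec (w x t))"] that(4,5) by auto
    have reg: "regular (Suc 0) D u" "regular (Suc 0) D w"
      using that(2,3) by simp_all
    show ?thesis
      by (rule system_equation_cd[where u = u and w = w and x = x and t = t, OF that(1)
            Ck_on_Suc_has_field_derivative[OF smooth_on_openD[OF assms(1,4)] uI]
            regular_D[OF reg(1) that(5)] regular_D[OF reg(2) that(5)]])
  qed
  have orig: "scaled_system f b \<epsilon> u (\<lambda>y s. \<epsilon> * v y s) x t \<longleftrightarrow> original_system f b \<epsilon> u v x t"
    if "0 < \<epsilon>" "regular 1 D v" "(x, t) \<in> D" for \<epsilon> D u v x t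
    by (rule scaled_system_iff_original_system[where v = v and x = x and t = t, OF that(1)
          regular_D[OF that(2)[unfolded One_nat_def] that(3)]])
  have "smooth_coefficients \<Omega> (cd_A b) (cd_Q f)"
    by (rule smooth_coefficients_cd[OF assms(1,3,4) \<Omega>])
  moreover have "criterion_i \<Omega> (cd_Q f)"
    by (rule criterion_i_cd[OF assms(1,3) \<Omega>])
  moreover have "criterion_iii \<Omega> (cd_pos_region f b \<Omega>) (cd_A b) (cd_A0 f b)"
    using assms(5) \<Omega> by (intro criterion_iii_cd) auto
  ultimately show ?thesis
    by (intro conjI allI impI criterion_ii_cd criterion_iv_cd criterion_v_cd)
       (assumption | elim conjE, rule sys orig limit_equation_cd[OF assms(1,3,4)]; assumption)+
qed

end
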